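(* Let $n \in \mathbb{N}$ be such that $2^n-1$ is prime. Then the following system in the variables $x_1,\ldots,x_{n+8}$: \[ \begin{array}{rcl} x_i \cdot x_i &=& x_{i+1} \quad \text{for every } i \in \{1,\ldots,n\}, \\ x_{n+2} &=& 1, \\ x_{n+3}+x_{n+2} &=& x_{n+4}, \\ x_{n+4}+x_{n+2} &=& x_{n+5}, \\ x_{n+5}+x_{n+2} &=& x_1, \\ x_{n+5} \cdot x_{n+5} &=& x_{n+6}, \\ x_{n+6} \cdot x_{n+7} &=& x_{n+8}, \\ x_{n+8}+x_1 &=& x_{n+1} \end{array} \] has a unique solution $(x_1,\ldots,x_{n+8})$ in non-negative integers, and for this solution $\max(x_1,\ldots,x_{n+8}) = x_{n+1} = (2^n)^{2^n}$.
   Context: $\mathbb{N}$ denotes the set of non-negative integers. *)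

theory Defs
  imports "HOL-Computational_Algebra.Primes" "HOL-Library.FuncSet"
begin

text \<open>
  A tuple \<open>(x\<^sub>1, \<dots>, x\<^sub>m)\<close> of non-negative integers is an element of
  \<open>{1..m} \<rightarrow>\<^sub>E UNIV\<close>: extensionality makes equality of such functions
  equality of tuples, so that uniqueness is meaningful.
\<close>

definition nat_tuples :: "nat \<Rightarrow> (nat \<Rightarrow> nat) set" where
  "nat_tuples m = {1..m} \<rightarrow>\<^sub>E UNIV"

definition satisfies_system :: "nat \<Rightarrow> (nat \<Rightarrow> nat) \<Rightarrow> bool" where
  "satisfies_system n x \<longleftrightarrow>
     (\<forall>i\<in>{1..n}. x i * x i = x (i + 1)) \<and>
     x (n + 2) = 1 \<and>
     x (n + 3) + x (n + 2) = x (n + 4) \<and>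
     x (n + 4) + x (n + 2) = x (n + 5) \<and>
     x (n + 5) + x (n + 2) = x 1 \<and>
     x (n + 5) * x (n + 5) = x (n + 6) \<and>
     x (n + 6) * x (n + 7) = x (n + 8) \<and>
     x (n + 8) + x 1 = x (n + 1)"

end

theory Submission imports Defs begin

text \<open>
  Put \<open>t = x\<^sub>n\<^sub>+\<^sub>5\<close>, so that \<open>t \<ge> 2\<close>, \<open>x\<^sub>1 = 1 + t\<close> and \<open>x\<^sub>n\<^sub>+\<^sub>1 = (1 + t) ^ (2 ^ n)\<close>.
  The last three equations say that \<open>t\<^sup>2\<close> divides \<open>x\<^sub>n\<^sub>+\<^sub>1 - x\<^sub>1\<close>. Modulo \<open>t\<^sup>2\<close> this difference
  is \<open>(2 ^ n - 1) t\<close>, hence \<open>t\<close> divides the prime \<open>2 ^ n - 1\<close> and equals it. Every other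
  unknown is then determined, and reading the argument backwards gives existence.
\<close>

text \<open>All binomial terms beyond the linear one contain \<open>t\<^sup>2\<close>. The explicit
  cofactor \<open>q\<close> avoids subtraction and later supplies a witness for existence.\<close>

lemma binomial_mod_square:
  fixes t :: nat
  shows "\<exists>q. (1 + t) ^ N = 1 + N * t + t\<^sup>2 * q"
proof (induction N)
  case 0
  show ?case by (intro exI[of _ 0]) simp
next
  case (Suc N)
  then obtain q where q: "(1 + t) ^ N = 1 + N * t + t\<^sup>2 * q" by blast
  have "(1 + t) ^ Suc N = 1 + Suc N * t + t\<^sup>2 * (N + q + t * q)"
    by (simp only: power_Suc q) (simp add: algebra_simps power2_eq_square)
  then show ?case by blast
qed

lemma repeated_squaring:
  fixes x :: "nat \<Rightarrow> 'a::monoid_mult"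
  assumes "\<forall>i\<in>{1..n}. x i * x i = x (i + 1)" and "j \<le> n"
  shows "x (j + 1) = x 1 ^ (2 ^ j)"
  using assms(2)
proof (induction j)
  case 0
  show ?case by simp
next
  case (Suc j)
  have "x (Suc j + 1) = x (j + 1) * x (j + 1)"
    using bspec[OF assms(1), of "j + 1"] Suc.prems by simp
  also have "\<dots> = x 1 ^ (2 ^ Suc j)"
    using Suc by (simp add: mult_2 power_add)
  finally show ?case .
qed

text \<open>Modulo \<open>t\<^sup>2\<close> the power is \<open>1 + (m + 1) * t\<close>; cancelling
  \<open>1 + t\<close> leaves \<open>m * t\<close>, and one factor \<open>t\<close> can be divided
  out.\<close>

lemma square_dvd_power_diff_imp_dvd:
  fixes t :: nat
  assumes "t > 0" and "t\<^sup>2 * y + (1 + t) = (1 + t) ^ (m + 1)"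
  shows "t dvd m"
proof -
  obtain q where "(1 + t) ^ (m + 1) = 1 + (m + 1) * t + t\<^sup>2 * q"
    using binomial_mod_square by blast
  with assms(2) have "t * (t * y) = t * (m + t * q)"
    by (simp add: algebra_simps power2_eq_square)
  with assms(1) have "t * y = m + t * q" by simp
  then show ?thesis
    by (metis dvd_add_left_iff dvd_triv_left)
qed

text \<open>Closed forms in \<open>n\<close> alone: any two solutions agree with them, which gives
  uniqueness, and the size comparison can be read off.\<close>

lemma solution_values:
  assumes prime: "prime (2 ^ n - 1 :: nat)" and sys: "satisfies_system n x"
  shows "j \<le> n \<Longrightarrow> x (j + 1) = (2 ^ n) ^ (2 ^ j)"
    and "x (n + 2) = 1" and "x (n + 3) = 2 ^ n - 3"
    and "x (n + 4) = 2 ^ n - 2" and "x (n + 5) = 2 ^ n - 1"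
    and "x (n + 6) = (2 ^ n - 1)\<^sup>2"
    and "x (n + 7) = ((2 ^ n) ^ (2 ^ n) - 2 ^ n) div (2 ^ n - 1)\<^sup>2"
    and "x (n + 8) = (2 ^ n) ^ (2 ^ n) - 2 ^ n"
proof -
  let ?t = "x (n + 5)"
  from sys have sq: "\<forall>i\<in>{1..n}. x i * x i = x (i + 1)"
    and x2: "x (n + 2) = 1" and x4: "x (n + 4) = x (n + 3) + 1"
    and t: "?t = x (n + 3) + 2" and x1: "x 1 = 1 + ?t"
    and x6: "x (n + 6) = ?t\<^sup>2" and x8: "x (n + 8) = ?t\<^sup>2 * x (n + 7)"
    and last: "x (n + 8) + x 1 = x (n + 1)"
    unfolding satisfies_system_def by (auto simp: power2_eq_square)
  have pow: "x (j + 1) = x 1 ^ (2 ^ j)" if "j \<le> n" for j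
    using repeated_squaring[OF sq that] .
  \<comment> \<open>The exponent \<open>2 ^ n\<close> is split as \<open>(2 ^ n - 1) + 1\<close>, so
    that the prime takes the role of \<open>m\<close>.\<close>
  have "?t\<^sup>2 * x (n + 7) + (1 + ?t) = (1 + ?t) ^ ((2 ^ n - 1) + 1)"
    using last pow[of n] x8 x1 by simp
  then have "?t dvd 2 ^ n - 1"
    by (rule square_dvd_power_diff_imp_dvd[rotated]) (simp add: t)
  \<comment> \<open>A divisor of a prime is 1 or the prime itself, and
    \<open>?t = x (n + 3) + 2\<close> excludes 1.\<close>
  with prime t show t': "?t = 2 ^ n - 1"
    by (auto simp: prime_nat_iff)
  with x1 have x1': "x 1 = 2 ^ n" by simp
  show "x (j + 1) = (2 ^ n) ^ (2 ^ j)" if "j \<le> n"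
    using pow[OF that] x1' by (simp only:)
  show "x (n + 2) = 1" by (fact x2)
  show "x (n + 3) = 2 ^ n - 3" "x (n + 4) = 2 ^ n - 2"
    using t t' x4 by auto
  show "x (n + 6) = (2 ^ n - 1)\<^sup>2" using x6 t' by simp
  show x8': "x (n + 8) = (2 ^ n) ^ (2 ^ n) - 2 ^ n"
    using last pow[of n] x1' by simp
  have "?t\<^sup>2 \<noteq> 0" using t by simp
  then have "x (n + 7) = x (n + 8) div ?t\<^sup>2" using x8 by simp
  then show "x (n + 7) = ((2 ^ n) ^ (2 ^ n) - 2 ^ n) div (2 ^ n - 1)\<^sup>2"
    using x8' t' by simp
qed

lemma index_cases:
  fixes i n :: nat
  assumes "i \<in> {1..n + 8}"
  obtains j where "j \<le> n" "i = j + 1"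
    | "i = n + 2" | "i = n + 3" | "i = n + 4" | "i = n + 5"
    | "i = n + 6" | "i = n + 7" | "i = n + 8"
proof (cases "i \<le> n + 1")
  case True
  with assms have "i - 1 \<le> n" "i = (i - 1) + 1" by auto
  then show ?thesis by (rule that(1))
next
  case False
  with assms have "i = n + 2 \<or> i = n + 3 \<or> i = n + 4 \<or> i = n + 5
      \<or> i = n + 6 \<or> i = n + 7 \<or> i = n + 8"
    by auto
  then show ?thesis using that by blast
qed

lemma solution_unique:
  assumes "prime (2 ^ n - 1 :: nat)"
    and "x \<in> nat_tuples (n + 8)" "satisfies_system n x"
    and "y \<in> nat_tuples (n + 8)" "satisfies_system n y"
  shows "x = y"
proof (rule PiE_ext)
  show "x \<in> {1..n + 8} \<rightarrow>\<^sub>E UNIV" "y \<in> {1..n + 8} \<rightarrow>\<^sub>E UNIV"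
    using assms(2,4) by (simp_all add: nat_tuples_def)
  fix i assume "i \<in> {1..n + 8}"
  then show "x i = y i"
    by (cases rule: index_cases)
      (simp_all only: solution_values[OF assms(1,3)] solution_values[OF assms(1,5)])
qed

lemma solution_exists:
  assumes "prime (2 ^ n - 1 :: nat)"
  shows "\<exists>x. x \<in> nat_tuples (n + 8) \<and> satisfies_system n x"
proof -
  define t :: nat where "t = 2 ^ n - 1"
  \<comment> \<open>This makes \<open>t - 2\<close> and \<open>t - 1\<close> below genuine
    differences.\<close>
  have t2: "t \<ge> 2" using assms prime_ge_2_nat by (simp add: t_def)
  have a: "2 ^ n = 1 + t" by (simp add: t_def)
  obtain q where q: "(1 + t) ^ (1 + t) = 1 + (1 + t) * t + t\<^sup>2 * q"
    using binomial_mod_square by blast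
  \<comment> \<open>The list starts at index \<open>n + 2\<close>. Its entry \<open>1 + q\<close> is
    forced: subtracting \<open>1 + t\<close> from the expansion in \<open>q\<close> leaves
    \<open>t\<^sup>2 * (1 + q)\<close>.\<close>
  define f where "f = (\<lambda>i. if i \<le> n + 1 then (1 + t) ^ (2 ^ (i - 1))
      else ([1, t - 2, t - 1, t, t\<^sup>2, 1 + q, t\<^sup>2 * (1 + q)] ! (i - (n + 2))))"
  define x where "x = restrict f {1..n + 8}"
  have low: "x i = (1 + t) ^ (2 ^ (i - 1))" if "i \<in> {1..n + 1}" for i
    using that by (simp add: x_def f_def)
  have sq: "x i * x i = x (i + 1)" if "i \<in> {1..n}" for i
  proof -
    from that obtain j where "i = Suc j" by (cases i) auto
    with that show ?thesis
      by (simp add: low mult_2 power_add)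
  qed
  have vals: "x (n + 2) = 1" "x (n + 3) = t - 2" "x (n + 4) = t - 1" "x (n + 5) = t"
    "x (n + 6) = t\<^sup>2" "x (n + 7) = 1 + q" "x (n + 8) = t\<^sup>2 * (1 + q)"
    by (simp_all add: x_def f_def)
  have "x (n + 1) = (1 + t) ^ (1 + t)" "x 1 = 1 + t"
    using low[of "n + 1"] low[of 1] a by simp_all
  then have "satisfies_system n x"
    unfolding satisfies_system_def vals
    using sq t2 q by (auto simp: power2_eq_square algebra_simps)
  moreover have "x \<in> nat_tuples (n + 8)"
    by (simp add: x_def nat_tuples_def)
  ultimately show ?thesis by blast
qed

text \<open>The repeated squares have exponents at most \<open>2 ^ n\<close>,
  \<open>x (n + 8)\<close> is \<open>x (n + 1)\<close> minus \<open>x 1\<close>, its two factors are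
  bounded by it, and the remaining values lie below \<open>2 ^ n\<close>.\<close>

lemma solution_le:
  assumes "prime (2 ^ n - 1 :: nat)" and "satisfies_system n x" and "i \<in> {1..n + 8}"
  shows "x i \<le> x (n + 1)"
proof -
  define a :: nat where "a = 2 ^ n"
  note vals = solution_values[OF assms(1,2), folded a_def]
  have a: "a \<ge> 3" using prime_ge_2_nat[OF assms(1)] unfolding a_def by linarith
  have top: "x (n + 1) = a ^ a" using vals(1)[of n] by (simp only: a_def le_refl)
  have "a ^ 1 < a ^ a" using a by (intro power_strict_increasing) auto
  then have lt: "a < x (n + 1)" by (simp only: top power_one_right)
  have prod: "x (n + 6) * x (n + 7) = x (n + 8)"
    using assms(2) unfolding satisfies_system_def by blast
  \<comment> \<open>Positivity matters: a divisor is bounded only by a nonzero multiple.\<close>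
  have x8: "0 < x (n + 8)" "x (n + 8) \<le> x (n + 1)"
    using lt unfolding vals(8) top by linarith+
  have "x (n + 6) dvd x (n + 8)" "x (n + 7) dvd x (n + 8)"
    unfolding prod[symmetric] by (rule dvd_triv_left, rule dvd_triv_right)
  with x8 have x67: "x (n + 6) \<le> x (n + 1)" "x (n + 7) \<le> x (n + 1)"
    by (meson dvd_imp_le le_trans)+
  show ?thesis
    using assms(3)
  proof (cases rule: index_cases)
    case (1 j)
    have "2 ^ j \<le> a"
      unfolding a_def using 1 by (intro power_increasing) auto
    then have "a ^ (2 ^ j) \<le> a ^ a"
      using a by (intro power_increasing) auto
    then show ?thesis using 1 vals(1)[of j] top by simp
  qed (use a lt x8 x67 vals(2-5) in simp_all)
qed

theorem theorem2:
  fixes n :: nat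
  assumes "prime (2 ^ n - 1 :: nat)"
  shows "(\<exists>!x. x \<in> nat_tuples (n + 8) \<and> satisfies_system n x) \<and>
    (\<forall>x. x \<in> nat_tuples (n + 8) \<and> satisfies_system n x \<longrightarrow>
      Max (x ` {1..n + 8}) = x (n + 1) \<and> x (n + 1) = (2 ^ n) ^ (2 ^ n))"
proof (intro conjI allI impI)
  show "\<exists>!x. x \<in> nat_tuples (n + 8) \<and> satisfies_system n x"
    using solution_exists[OF assms] solution_unique[OF assms] by blast
next
  fix x assume x: "x \<in> nat_tuples (n + 8) \<and> satisfies_system n x"
  then show "Max (x ` {1..n + 8}) = x (n + 1)"
    using solution_le[OF assms] by (intro Max_eqI) auto
  show "x (n + 1) = (2 ^ n) ^ (2 ^ n)"
    using solution_values(1)[OF assms, of x n] x by simp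
qed

end
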